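(* Let $\nu>1/2$. Let $f:(0,\infty)\to[0,\infty)$ be a sectionally continuous and decreasing function that does not vanish identically, with $$\int_0^1 t^{\nu+1/2}f(t)\,dt<\infty\quad\text{and}\quad\lim_{t\to\infty}f(t)=0.$$ Then for all $x>0$, $$(H_\nu f)(x)=\int_0^\infty f(t)\,J_\nu(xt)\sqrt{xt}\,dt>0.$$
   Context: $J_\nu$ is the Bessel function of the first kind of order $\nu$. "Decreasing" means non-increasing. "Sectionally continuous" means piecewise continuous: on each compact subinterval of $(0,\infty)$ there are at most finitely many discontinuities, all with finite one-sided limits. Integrals over $(0,\infty)$ are improper integrals $\lim_{\epsilon\to0+,\,R\to\infty}\int_\epsilon^R$, possibly only conditionally convergent at infinity; the statement includes that this integral converges. *)

theory Defs
  imports "HOL-Analysis.Analysis"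
begin

text \<open>The Bessel function of the first kind of real order \<open>\<nu>\<close>, by its power series.
  The reciprocal Gamma function vanishes at the poles of Gamma, so this is meaningful
  for every real \<open>\<nu>\<close>; because of \<open>powr\<close> it is the Bessel function only for arguments \<open>z > 0\<close>.\<close>

definition bessel_J :: "real \<Rightarrow> real \<Rightarrow> real" where
  "bessel_J \<nu> z =
     (z / 2) powr \<nu> * (\<Sum>k. (-1) ^ k * rGamma (\<nu> + real k + 1) / fact k * (z / 2) ^ (2 * k))"

text \<open>Functions on \<open>(0,\<infinity>)\<close> are modelled by total functions, whose values outside \<open>(0,\<infinity>)\<close> are
  irrelevant. As \<open>(0,\<infinity>)\<close> is open, \<open>isCont\<close> at a point of it depends only on the values there.\<close>

definition sectionally_continuous :: "(real \<Rightarrow> real) \<Rightarrow> bool" where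
  "sectionally_continuous f \<longleftrightarrow>
     (\<forall>a b. 0 < a \<and> a \<le> b \<longrightarrow>
        finite {t \<in> {a..b}. \<not> isCont f t} \<and>
        (\<forall>t \<in> {a..b}. \<not> isCont f t \<longrightarrow>
           (\<exists>l. (f \<longlongrightarrow> l) (at_left t)) \<and> (\<exists>r. (f \<longlongrightarrow> r) (at_right t))))"

text \<open>Improper integrals over \<open>(0,\<infinity>)\<close>: both endpoints tend to their limits independently.\<close>

definition improper_integrable :: "(real \<Rightarrow> real) \<Rightarrow> bool" where
  "improper_integrable g \<longleftrightarrow>
     (\<forall>\<epsilon> R. 0 < \<epsilon> \<and> \<epsilon> \<le> R \<longrightarrow> g integrable_on {\<epsilon>..R}) \<and>
     (\<exists>I. ((\<lambda>(\<epsilon>, R). integral {\<epsilon>..R} g) \<longlongrightarrow> I) (at_right 0 \<times>\<^sub>F at_top))"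

definition improper_integral :: "(real \<Rightarrow> real) \<Rightarrow> real" where
  "improper_integral g = Lim (at_right 0 \<times>\<^sub>F at_top) (\<lambda>(\<epsilon>, R). integral {\<epsilon>..R} g)"

definition hankel_integrand :: "real \<Rightarrow> (real \<Rightarrow> real) \<Rightarrow> real \<Rightarrow> real \<Rightarrow> real" where
  "hankel_integrand \<nu> f x t = f t * bessel_J \<nu> (x * t) * sqrt (x * t)"

definition hankel_transform :: "real \<Rightarrow> (real \<Rightarrow> real) \<Rightarrow> real \<Rightarrow> real" where
  "hankel_transform \<nu> f x = improper_integral (hankel_integrand \<nu> f x)"

end

(* The kernel phi(t) = sqrt t * J_nu(t) satisfies phi'' = -q phi with q = 1 - c/t^2 and
   c = nu^2 - 1/4 > 0.  With G(t) the integral of phi over (0,t), the function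
   W = phi^2/2 - q G^2/2 - phi' G has derivative -c G^2/t^3 and limit 0 at 0, so W < 0.
   As W = phi^2/2 >= 0 at a zero of G, the integral G has no zero; it is thus positive, and the bound
   W <= W(a) < 0 on [a,oo) even keeps it away from 0 there.  By the second mean value theorem,
   the integral of f(t) phi(xt) over (0,R) is at least f(a) G(xc)/x for some c >= a, up to an
   error that vanishes as R tends to infinity. *)

theory Submission
  imports Defs
begin

section \<open>Energy functions for the equation phi'' = - (1 - c / t^2) phi and a primitive of
  phi\<close>

section \<open>A primitive without zeros\<close>

text \<open>Isolates what is used of sqrt t * J_nu(t): \<open>\<psi>\<close> is the derivative of
  \<open>\<phi>\<close>, and \<open>G\<close> is the primitive that tends to 0 at 0. The limit of
  \<open>G t / t\<close> controls the singular term c G^2 / (2 t^2) of \<open>W\<close>.\<close>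

locale sturm_kernel =
  fixes \<phi> \<psi> G :: "real \<Rightarrow> real" and c \<delta> :: real
  assumes c_pos: "c > 0" and \<delta>_pos: "\<delta> > 0"
    and \<phi>_pos: "\<And>t. 0 < t \<Longrightarrow> t < \<delta> \<Longrightarrow> \<phi> t > 0"
    and deriv_\<phi>: "\<And>t. t > 0 \<Longrightarrow> (\<phi> has_real_derivative \<psi> t) (at t)"
    and deriv_\<psi>: "\<And>t. t > 0 \<Longrightarrow> (\<psi> has_real_derivative - (1 - c / t\<^sup>2) * \<phi> t) (at t)"
    and deriv_G: "\<And>t. t > 0 \<Longrightarrow> (G has_real_derivative \<phi> t) (at t)"
    and tendsto_\<phi>: "(\<phi> \<longlongrightarrow> 0) (at_right 0)"
    and tendsto_\<psi>: "(\<psi> \<longlongrightarrow> 0) (at_right 0)"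
    and tendsto_G: "(G \<longlongrightarrow> 0) (at_right 0)"
    and tendsto_G_div: "((\<lambda>t. G t / t) \<longlongrightarrow> 0) (at_right 0)"
begin

lemma continuous_on_G: "continuous_on {0<..} G"
  and continuous_on_\<psi>: "continuous_on {0<..} \<psi>"
  by (auto intro!: continuous_at_imp_continuous_on DERIV_isCont[OF deriv_G]
      DERIV_isCont[OF deriv_\<psi>])

lemma G_pos_near_0:
  assumes "0 < t" "t < \<delta>"
  shows "G t > 0"
proof -
  have mono: "G r < G s" if "0 < r" "r < s" "s < \<delta>" for r s
  proof (rule DERIV_pos_imp_increasing[OF that(2), of G])
    fix x assume "r \<le> x" "x \<le> s"
    with that show "\<exists>y. (G has_real_derivative y) (at x) \<and> y > 0"
      by (intro exI[of _ "\<phi> x"] conjI deriv_G \<phi>_pos) auto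
  qed
  \<comment> \<open>The limit at 0 yields only a weak inequality; halving t leaves room for a strict
    increase from t/2 to t.\<close>
  have "0 \<le> G (t/2)"
  proof (rule tendsto_upperbound[OF tendsto_G])
    show "\<forall>\<^sub>F s in at_right 0. G s \<le> G (t/2)"
      using assms mono by (intro eventually_at_rightI[of 0 "t/2"]) (auto intro!: less_imp_le mono)
  qed auto
  also have "G (t/2) < G t" using assms by (intro mono) auto
  finally show ?thesis .
qed

text \<open>For constant q this would be a first integral of G''' = - q G'; a varying q disturbs
  conservation only by the term - q' G^2 / 2.\<close>

definition W :: "real \<Rightarrow> real" where
  "W t = (\<phi> t)\<^sup>2 / 2 - (1 - c / t\<^sup>2) * (G t)\<^sup>2 / 2 - \<psi> t * G t"

text \<open>With phi' = psi and psi' = - q phi, the products phi psi and q phi G cancel; what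
  remains is - q' G^2 / 2 with q' = 2 c / t^3.\<close>

lemma deriv_W:
  assumes "t > 0"
  shows "(W has_real_derivative - (c * (G t)\<^sup>2 / t ^ 3)) (at t)"
  unfolding W_def[abs_def] using assms
  by (auto intro!: derivative_eq_intros deriv_\<phi> deriv_\<psi> deriv_G
      simp: field_simps power2_eq_square power3_eq_cube)

lemma tendsto_W: "(W \<longlongrightarrow> 0) (at_right 0)"
proof -
  have "((\<lambda>t. (\<phi> t)\<^sup>2 / 2 - (G t)\<^sup>2 / 2 + c * (G t / t)\<^sup>2 / 2 - \<psi> t * G t)
          \<longlongrightarrow> 0\<^sup>2 / 2 - 0\<^sup>2 / 2 + c * 0\<^sup>2 / 2 - 0 * 0) (at_right 0)"
    by (intro tendsto_intros tendsto_\<phi> tendsto_\<psi> tendsto_G tendsto_G_div) auto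
  then show ?thesis
    by (simp add: W_def[abs_def] power_divide algebra_simps diff_divide_distrib)
qed

lemma W_antimono:
  assumes "0 < s" "s \<le> t"
  shows "W t \<le> W s"
proof (rule DERIV_nonpos_imp_nonincreasing[OF assms(2)])
  fix x assume "s \<le> x" "x \<le> t"
  with assms c_pos show "\<exists>y. (W has_real_derivative y) (at x) \<and> y \<le> 0"
    by (intro exI[of _ "- (c * (G x)\<^sup>2 / x ^ 3)"]) (auto intro!: deriv_W)
qed

lemma W_nonpos:
  assumes "t > 0"
  shows "W t \<le> 0"
proof (rule tendsto_lowerbound[OF tendsto_W])
  show "\<forall>\<^sub>F s in at_right 0. W t \<le> W s"
    using assms by (intro eventually_at_rightI[of 0 t]) (auto intro: W_antimono)
qed auto

text \<open>The derivative of \<open>W\<close> is strictly negative near 0, where \<open>G\<close>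
  does not vanish, so \<open>W\<close> drops strictly below its nonpositive values there and never
  recovers.\<close>

lemma W_neg:
  assumes "t > 0"
  shows "W t < 0"
proof -
  define s where "s = min t (\<delta>/2)"
  have s: "0 < s" "s \<le> t" "s < \<delta>" using assms \<delta>_pos by (auto simp: s_def)
  have "W s < W (s/2)"
  proof (rule DERIV_neg_imp_decreasing[of "s/2" s W])
    fix x assume x: "s/2 \<le> x" "x \<le> s"
    then have "G x > 0" "x > 0" using s by (auto intro!: G_pos_near_0)
    then show "\<exists>y. (W has_real_derivative y) (at x) \<and> y < 0"
      using c_pos by (intro exI[of _ "- (c * (G x)\<^sup>2 / x ^ 3)"]) (auto intro!: deriv_W)
  qed (use s in auto)
  with W_antimono[OF s(1,2)] W_nonpos[of "s/2"] s show ?thesis by auto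
qed

text \<open>A nonpositive value at t would force a zero between t and a point near 0 where
  \<open>G\<close> is positive; at a zero, \<open>W\<close> reduces to phi^2 / 2, against
  \<open>W_neg\<close>.\<close>

lemma G_pos:
  assumes "t > 0"
  shows "G t > 0"
proof (rule ccontr)
  assume "\<not> G t > 0"
  define s where "s = min t (\<delta>/2)"
  have s: "0 < s" "s \<le> t" "s < \<delta>" using assms \<delta>_pos by (auto simp: s_def)
  have "continuous_on {s..t} G"
    using s by (intro continuous_on_subset[OF continuous_on_G]) auto
  then obtain z where z: "s \<le> z" "z \<le> t" "G z = 0"
    using IVT2'[of G t 0 s] \<open>\<not> G t > 0\<close> G_pos_near_0[OF s(1,3)] s by auto
  then have "W z \<ge> 0" by (simp add: W_def)
  with W_neg[of z] s z show False by auto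
qed

text \<open>The Sonin-type energy psi^2 / q + phi^2 has derivative - q' psi^2 / q^2, which is
  nonpositive because q increases; so both functions stay bounded at infinity.\<close>

lemma \<phi>_\<psi>_bounded:
  obtains T M where "T > 0" "M > 0" "\<And>t. t \<ge> T \<Longrightarrow> \<bar>\<phi> t\<bar> \<le> M" "\<And>t. t \<ge> T \<Longrightarrow> \<bar>\<psi> t\<bar> \<le> M"
proof -
  \<comment> \<open>For t \<ge> \<open>T\<close> one has t^2 \<ge> 2 c, so q lies between 1/2 and 1
    and may be divided by.\<close>
  define T where "T = sqrt (2 * c)"
  have T: "T > 0" using c_pos by (simp add: T_def)
  define q where "q t = 1 - c / t\<^sup>2" for t
  have q: "1/2 \<le> q t" "q t \<le> 1" if "t \<ge> T" for t
  proof -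
    have "2 * c \<le> t\<^sup>2" using that c_pos unfolding T_def using real_sqrt_le_iff sqrt_le_D by blast
    moreover have "t > 0" using that T by simp
    ultimately show "1/2 \<le> q t" by (simp add: q_def field_simps)
    show "q t \<le> 1" using c_pos by (simp add: q_def)
  qed
  have q_deriv: "(q has_real_derivative 2 * c / t ^ 3) (at t)" if "t > 0" for t
    unfolding q_def[abs_def] using that
    by (auto intro!: derivative_eq_intros simp: field_simps power2_eq_square power3_eq_cube)
  define E where "E t = (\<psi> t)\<^sup>2 / q t + (\<phi> t)\<^sup>2" for t
  have E_deriv: "(E has_real_derivative - (2 * c / t ^ 3) * (\<psi> t)\<^sup>2 / (q t)\<^sup>2) (at t)" if "t \<ge> T" for t
  proof -
    have "t > 0" "q t > 0" using T that q[OF that] by auto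
    then show ?thesis
      unfolding E_def[abs_def]
      by (auto intro!: derivative_eq_intros deriv_\<phi> deriv_\<psi> q_deriv
          simp: q_def[symmetric])
         (simp add: field_simps power2_eq_square)
  qed
  have E_le: "E t \<le> E T" if "t \<ge> T" for t
  proof (rule DERIV_nonpos_imp_nonincreasing[OF that])
    fix x assume "T \<le> x" "x \<le> t"
    with T c_pos show "\<exists>y. (E has_real_derivative y) (at x) \<and> y \<le> 0"
      by (intro exI[of _ "- (2 * c / x ^ 3) * (\<psi> x)\<^sup>2 / (q x)\<^sup>2"] conjI E_deriv) auto
  qed
  define M where "M = sqrt (E T) + 1"
  have M: "M > 0" using q[of T] by (auto simp: M_def E_def intro!: add_nonneg_pos)
  have "\<bar>\<phi> t\<bar> \<le> M \<and> \<bar>\<psi> t\<bar> \<le> M" if "t \<ge> T" for t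
  proof -
    have "(\<phi> t)\<^sup>2 \<le> E t" using q[OF that] by (simp add: E_def)
    then have 1: "\<bar>\<phi> t\<bar> \<le> sqrt (E T)"
      using E_le[OF that] by (metis order.trans real_sqrt_abs real_sqrt_le_mono)
    \<comment> \<open>Division by q \<le> 1 can only enlarge psi^2, so the energy controls psi as
      well as phi.\<close>
    have "(\<psi> t)\<^sup>2 * q t \<le> (\<psi> t)\<^sup>2 * 1" using q[OF that] by (intro mult_left_mono) auto
    then have "(\<psi> t)\<^sup>2 \<le> (\<psi> t)\<^sup>2 / q t" using q[OF that] by (simp add: field_simps)
    also have "\<dots> \<le> E t" by (simp add: E_def)
    finally have "\<bar>\<psi> t\<bar> \<le> sqrt (E T)"
      using E_le[OF that] by (metis order.trans real_sqrt_abs real_sqrt_le_mono)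
    with 1 show ?thesis by (simp add: M_def)
  qed
  with T M that show ?thesis by blast
qed

text \<open>Since phi = - psi' + c phi / t^2, the sum G + psi changes only by the integral of c phi
  / t^2, which converges at infinity.\<close>

lemma G_bounded: obtains K where "\<And>t. t > 0 \<Longrightarrow> G t \<le> K"
proof -
  obtain T M where T: "T > 0" "M > 0" and \<phi>: "\<And>t. t \<ge> T \<Longrightarrow> \<bar>\<phi> t\<bar> \<le> M"
    and \<psi>: "\<And>t. t \<ge> T \<Longrightarrow> \<bar>\<psi> t\<bar> \<le> M"
    using \<phi>_\<psi>_bounded by blast
  \<comment> \<open>The derivative - c M / t^2 of the last term outweighs c phi / t^2 on [T, oo),
    which makes \<open>B\<close> nonincreasing there.\<close>
  define B where "B t = G t + \<psi> t + c * M / t" for t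
  have B_le: "B t \<le> B T" if "t \<ge> T" for t
  proof (rule DERIV_nonpos_imp_nonincreasing[OF that])
    fix x assume x: "T \<le> x" "x \<le> t"
    have "(B has_real_derivative c * (\<phi> x - M) / x\<^sup>2) (at x)"
      unfolding B_def[abs_def] using x T
      by (auto intro!: derivative_eq_intros deriv_G deriv_\<psi> simp: field_simps power2_eq_square)
    moreover have "c * (\<phi> x - M) / x\<^sup>2 \<le> 0"
      using c_pos \<phi>[OF x(1)] by (auto simp: divide_le_0_iff mult_le_0_iff)
    ultimately show "\<exists>y. (B has_real_derivative y) (at x) \<and> y \<le> 0" by blast
  qed
  have far: "G t \<le> B T + M" if "t \<ge> T" for t
  proof -
    have "G t \<le> B t - \<psi> t" using that T c_pos by (simp add: B_def)
    with B_le[OF that] \<psi>[OF that] show ?thesis by linarith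
  qed
  \<comment> \<open>It remains to bound \<open>G\<close> on (0, T]: the limit at 0 handles (0, b),
    compactness handles [b, T].\<close>
  have near_0: "\<forall>\<^sub>F t in at_right 0. G t < 1"
    using order_tendstoD(2)[OF tendsto_G] by simp
  then obtain b where b: "b > 0" "\<And>t. 0 < t \<Longrightarrow> t < b \<Longrightarrow> G t < 1"
    by (auto simp: eventually_at_right_field)
  have "compact (G ` {b..T})"
    using b by (intro compact_continuous_image continuous_on_subset[OF continuous_on_G]) auto
  then have "bdd_above (G ` {b..T})" by (intro bounded_imp_bdd_above compact_imp_bounded)
  then obtain L where L: "\<And>t. b \<le> t \<Longrightarrow> t \<le> T \<Longrightarrow> G t \<le> L"
    unfolding bdd_above_def by (meson atLeastAtMost_iff imageI)
  have "G t \<le> max 1 (max L (B T + M))" if "t > 0" for t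
    using far[of t] L[of t] b(2)[of t] that by linarith
  then show ?thesis using that by blast
qed

text \<open>If K bounds G from above and N bounds |psi| on [a, oo), then 0 < - W(a) \<le> - W(t)
  \<le> G(t) (K / 2 + N) for t \<ge> a, so G cannot approach 0.\<close>

lemma G_bounded_below:
  assumes "a > 0"
  obtains m where "m > 0" "\<And>t. t \<ge> a \<Longrightarrow> G t \<ge> m"
proof -
  obtain T M where T: "T > 0" "M > 0" and "\<And>t. t \<ge> T \<Longrightarrow> \<bar>\<phi> t\<bar> \<le> M"
    and \<psi>: "\<And>t. t \<ge> T \<Longrightarrow> \<bar>\<psi> t\<bar> \<le> M"
    using \<phi>_\<psi>_bounded by blast
  have "compact (\<psi> ` {a..T})"
    using assms by (intro compact_continuous_image continuous_on_subset[OF continuous_on_\<psi>]) auto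
  then have "bounded (\<psi> ` {a..T})" by (rule compact_imp_bounded)
  then obtain L where "\<forall>x\<in>{a..T}. \<bar>\<psi> x\<bar> \<le> L" by (auto simp: bounded_iff)
  then have L: "\<And>t. a \<le> t \<Longrightarrow> t \<le> T \<Longrightarrow> \<bar>\<psi> t\<bar> \<le> L" by simp
  define N where "N = max M L"
  have N: "\<bar>\<psi> t\<bar> \<le> N" if "t \<ge> a" for t
    using \<psi>[of t] L[of t] that by (cases "t \<le> T") (auto simp: N_def le_max_iff_disj)
  have "N > 0" using T by (simp add: N_def)
  obtain K where K: "\<And>t. t > 0 \<Longrightarrow> G t \<le> K" using G_bounded by blast
  have "K > 0" using K[of 1] G_pos[of 1] by simp
  define m where "m = - W a / (K / 2 + N)"
  have "m > 0"
    unfolding m_def using W_neg[OF assms] \<open>N > 0\<close> \<open>K > 0\<close> by (intro divide_pos_pos add_pos_pos) auto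
  moreover have "G t \<ge> m" if "t \<ge> a" for t
  proof -
    have t: "t > 0" using that assms by simp
    note g = G_pos[OF t]
    have "1 - c / t\<^sup>2 \<le> 1" using c_pos t by simp
    define X where "X = (1 - c / t\<^sup>2) * (G t)\<^sup>2"
    have "X \<le> 1 * (G t)\<^sup>2" unfolding X_def using \<open>1 - c / t\<^sup>2 \<le> 1\<close> by (intro mult_right_mono) auto
    then have 1: "X \<le> (G t)\<^sup>2" by simp
    have 2: "(G t)\<^sup>2 \<le> K * G t" using K[OF t] g by (simp add: power2_eq_square mult_right_mono)
    have 3: "\<psi> t * G t \<le> N * G t" using N[OF that] g by (intro mult_right_mono) auto
    have "- W a \<le> - W t" using W_antimono[OF assms that] by simp
    also have "\<dots> = X / 2 + \<psi> t * G t - (\<phi> t)\<^sup>2 / 2" by (simp add: W_def X_def)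
    \<comment> \<open>From q \<le> 1 and G \<le> K one gets q G^2 \<le> K G; dropping - phi^2 / 2
      leaves only terms with a factor G.\<close>
    also have "\<dots> \<le> K * G t / 2 + N * G t" using 1 2 3 zero_le_power2[of "\<phi> t"] by linarith
    also have "\<dots> = G t * (K / 2 + N)" by (simp add: algebra_simps)
    finally show ?thesis using \<open>N > 0\<close> \<open>K > 0\<close> unfolding m_def by (subst pos_divide_le_eq) auto
  qed
  ultimately show ?thesis using that by blast
qed

end

section \<open>The power series of J_nu, its differential equation, and the kernel sqrt t *
  J_nu(t)\<close>

section \<open>The Bessel function\<close>

definition bessel_coeff :: "real \<Rightarrow> nat \<Rightarrow> real" where
  "bessel_coeff \<nu> k = (-1) ^ k * rGamma (\<nu> + real k + 1) / fact k"

text \<open>In the variable y = z^2 / 4 the Bessel series is an ordinary power series, open to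
  termwise differentiation. For \<nu> > 0 it is 0F1(; \<nu> + 1; - y) / Gamma(\<nu> + 1).\<close>

definition bessel_series :: "real \<Rightarrow> real \<Rightarrow> real" where
  "bessel_series \<nu> y = (\<Sum>k. bessel_coeff \<nu> k * y ^ k)"

definition bessel_series' :: "real \<Rightarrow> real \<Rightarrow> real" where
  "bessel_series' \<nu> y = (\<Sum>k. diffs (bessel_coeff \<nu>) k * y ^ k)"

definition bessel_series'' :: "real \<Rightarrow> real \<Rightarrow> real" where
  "bessel_series'' \<nu> y = (\<Sum>k. diffs (diffs (bessel_coeff \<nu>)) k * y ^ k)"

lemma bessel_J_eq: "bessel_J \<nu> z = (z / 2) powr \<nu> * bessel_series \<nu> (z\<^sup>2 / 4)"
proof -
  have "(z / 2) ^ (2 * k) = (z\<^sup>2 / 4) ^ k" for k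
    by (simp add: power_mult power_divide)
  then show ?thesis by (simp add: bessel_J_def bessel_series_def bessel_coeff_def)
qed

text \<open>The functional equation of the reciprocal Gamma function supplies one factor, the
  factorial the other. The form without division suits both the ratio test and the comparison of
  coefficients in the differential equation.\<close>

lemma bessel_coeff_Suc:
  "(real k + 1) * (\<nu> + real k + 1) * bessel_coeff \<nu> (Suc k) = - bessel_coeff \<nu> k"
proof -
  have "(\<nu> + real k + 1) * rGamma (\<nu> + real k + 1 + 1) = rGamma (\<nu> + real k + 1)"
    by (rule rGamma_plus1)
  then have "(real k + 1) * (\<nu> + real k + 1) * bessel_coeff \<nu> (Suc k)
      = (real k + 1) * (- 1) ^ Suc k * rGamma (\<nu> + real k + 1) / fact (Suc k)"
    by (simp add: bessel_coeff_def add_ac)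
  also have "\<dots> = - bessel_coeff \<nu> k"
  proof -
    have f: "fact (Suc k) = (real k + 1) * fact k" and nz: "real k + 1 \<noteq> 0" by simp_all
    have "(real k + 1) * (- 1) ^ Suc k * rGamma (\<nu> + real k + 1) / fact (Suc k)
        = (- 1) ^ Suc k * rGamma (\<nu> + real k + 1) / fact k"
      unfolding f mult.assoc using nz by (rule mult_divide_mult_cancel_left)
    then show ?thesis by (simp add: bessel_coeff_def)
  qed
  finally show ?thesis .
qed

lemma summable_bessel_coeff: 
  assumes "\<nu> > 0"
  shows "summable (\<lambda>k. bessel_coeff \<nu> k * y ^ k)"
proof (rule summable_ratio_test)
  \<comment> \<open>Beyond this index (k + 1) (\<nu> + k + 1) \<ge> 2 |y|, so each term is at most
    half of its predecessor in absolute value.\<close>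
  fix k assume "k \<ge> nat \<lceil>2 * \<bar>y\<bar>\<rceil>"
  then have k: "2 * \<bar>y\<bar> \<le> real k" by linarith
  have "\<bar>bessel_coeff \<nu> k\<bar> = (real k + 1) * (\<nu> + real k + 1) * \<bar>bessel_coeff \<nu> (Suc k)\<bar>"
  proof -
    have "bessel_coeff \<nu> k = - ((real k + 1) * (\<nu> + real k + 1) * bessel_coeff \<nu> (Suc k))"
      using bessel_coeff_Suc[of k \<nu>] by simp
    then show ?thesis using assms by (simp only: abs_minus_cancel abs_mult)
  qed
  also have "\<dots> \<ge> (2 * \<bar>y\<bar>) * 1 * \<bar>bessel_coeff \<nu> (Suc k)\<bar>"
    using k assms by (intro mult_right_mono mult_mono) auto
  finally have "2 * \<bar>y\<bar> * \<bar>bessel_coeff \<nu> (Suc k)\<bar> \<le> \<bar>bessel_coeff \<nu> k\<bar>" by simp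
  from mult_right_mono[OF this, of "\<bar>y\<bar> ^ k"]
  show "norm (bessel_coeff \<nu> (Suc k) * y ^ Suc k) \<le> 1/2 * norm (bessel_coeff \<nu> k * y ^ k)"
    by (simp add: abs_mult power_abs mult_ac)
qed auto

lemma summable_diffs_bessel_coeff:
  assumes "\<nu> > 0"
  shows "summable (\<lambda>k. diffs (bessel_coeff \<nu>) k * y ^ k)"
    and "summable (\<lambda>k. diffs (diffs (bessel_coeff \<nu>)) k * y ^ k)"
proof -
  \<comment> \<open>Stated for every y, since differentiating termwise once more requires
    convergence everywhere.\<close>
  show 1: "summable (\<lambda>k. diffs (bessel_coeff \<nu>) k * y ^ k)" for y
    by (rule termdiff_converges_all[OF summable_bessel_coeff[OF assms]])
  show "summable (\<lambda>k. diffs (diffs (bessel_coeff \<nu>)) k * y ^ k)"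
    by (rule termdiff_converges_all[OF 1])
qed

lemma bessel_series_deriv:
  assumes "\<nu> > 0"
  shows "(bessel_series \<nu> has_real_derivative bessel_series' \<nu> y) (at y)"
    and "(bessel_series' \<nu> has_real_derivative bessel_series'' \<nu> y) (at y)"
proof -
  show "(bessel_series \<nu> has_real_derivative bessel_series' \<nu> y) (at y)"
    unfolding bessel_series_def[abs_def] bessel_series'_def
    by (rule termdiffs_strong_converges_everywhere[OF summable_bessel_coeff[OF assms]])
  show "(bessel_series' \<nu> has_real_derivative bessel_series'' \<nu> y) (at y)"
    unfolding bessel_series'_def[abs_def] bessel_series''_def
    by (rule termdiffs_strong_converges_everywhere[OF summable_diffs_bessel_coeff(1)[OF assms]])
qed

lemma continuous_on_bessel_series:
  assumes "\<nu> > 0"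
  shows "continuous_on A (bessel_series \<nu>)" and "continuous_on A (bessel_series' \<nu>)"
  by (intro continuous_at_imp_continuous_on ballI DERIV_isCont[OF bessel_series_deriv(1)[OF assms]]
      DERIV_isCont[OF bessel_series_deriv(2)[OF assms]])+

text \<open>The coefficient of y^k on the left is (k + 1) (\<nu> + k + 1) a_(k+1) + a_k, which
  vanishes by \<open>bessel_coeff_Suc\<close>.\<close>

lemma bessel_series_ode:
  assumes "\<nu> > 0"
  shows "y * bessel_series'' \<nu> y + (\<nu> + 1) * bessel_series' \<nu> y + bessel_series \<nu> y = 0"
proof -
  define a where "a = bessel_coeff \<nu>"
  have "(\<lambda>k. diffs (diffs a) k * y ^ k) sums bessel_series'' \<nu> y"
    unfolding bessel_series''_def a_def by (intro summable_sums summable_diffs_bessel_coeff assms)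
  from sums_mult[OF this, of y]
  have "(\<lambda>k. real (Suc k) * diffs a (Suc k) * y ^ Suc k) sums (y * bessel_series'' \<nu> y)"
    by (simp add: diffs_def mult_ac)
  \<comment> \<open>Multiplication by y shifts the index by one; the missing term at k = 0 is 0 and
    can be added.\<close>
  then have "(\<lambda>k. real k * diffs a k * y ^ k) sums (y * bessel_series'' \<nu> y)"
    by (subst (asm) sums_Suc_iff) simp
  moreover have "(\<lambda>k. diffs a k * y ^ k) sums bessel_series' \<nu> y"
    unfolding bessel_series'_def a_def by (intro summable_sums summable_diffs_bessel_coeff assms)
  moreover have "(\<lambda>k. a k * y ^ k) sums bessel_series \<nu> y"
    unfolding bessel_series_def a_def by (intro summable_sums summable_bessel_coeff assms)
  ultimately have "(\<lambda>k. real k * diffs a k * y ^ k + (\<nu> + 1) * (diffs a k * y ^ k) + a k * y ^ k)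
      sums (y * bessel_series'' \<nu> y + (\<nu> + 1) * bessel_series' \<nu> y + bessel_series \<nu> y)"
    by (intro sums_add sums_mult)
  moreover have "real k * diffs a k * y ^ k + (\<nu> + 1) * (diffs a k * y ^ k) + a k * y ^ k = 0" for k
  proof -
    have "real k * diffs a k + (\<nu> + 1) * diffs a k + a k = 0"
      using bessel_coeff_Suc[of k \<nu>] by (simp add: a_def diffs_def algebra_simps)
    then show ?thesis by (metis distrib_right mult.assoc mult_zero_left)
  qed
  ultimately show ?thesis by (simp add: sums_iff)
qed

text \<open>This is sqrt t * J_nu(t) with its powers of t merged: the exponent \<nu> + 1/2 shows the
  behaviour at 0 and matches the weight in the integrability condition on f.\<close>

definition bessel_kernel :: "real \<Rightarrow> real \<Rightarrow> real" where
  "bessel_kernel \<nu> t = 2 powr - \<nu> * (t powr (\<nu> + 1/2) * bessel_series \<nu> (t\<^sup>2 / 4))"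

text \<open>The exponent \<nu> + 3/2 absorbs the factor t / 2 that the chain rule produces from t^2
  / 4.\<close>

definition bessel_kernel' :: "real \<Rightarrow> real \<Rightarrow> real" where
  "bessel_kernel' \<nu> t = 2 powr - \<nu> * ((\<nu> + 1/2) * t powr (\<nu> - 1/2) * bessel_series \<nu> (t\<^sup>2 / 4)
     + t powr (\<nu> + 3/2) / 2 * bessel_series' \<nu> (t\<^sup>2 / 4))"

lemma bessel_kernel_eq:
  assumes "t \<ge> 0"
  shows "bessel_J \<nu> t * sqrt t = bessel_kernel \<nu> t"
proof -
  have "t powr (\<nu> + 1/2) = t powr \<nu> * sqrt t"
    using assms by (simp add: powr_add powr_half_sqrt)
  moreover have "(t / 2) powr \<nu> = 2 powr - \<nu> * t powr \<nu>"
    using assms by (simp add: powr_divide powr_minus_divide)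
  ultimately show ?thesis
    by (simp only: bessel_J_eq bessel_kernel_def mult_ac)
qed

lemma deriv_bessel_kernel:
  assumes "\<nu> > 0" "t > 0"
  shows "(bessel_kernel \<nu> has_real_derivative bessel_kernel' \<nu> t) (at t)"
proof -
  have "t powr (\<nu> + 3/2) = t * t powr (\<nu> + 1/2)"
    using powr_mult_base[of t "\<nu> + 1/2"] assms by (simp add: add_ac)
  then show ?thesis
    unfolding bessel_kernel_def[abs_def] bessel_kernel'_def using assms
    by (auto intro!: derivative_eq_intros DERIV_chain2[OF bessel_series_deriv(1)]
        simp: field_simps)
qed

text \<open>The factor sqrt t removes the first-order term from Bessel's equation. In terms of the
  series, this is \<open>bessel_series_ode\<close> at y = t^2 / 4 once a common power of t is
  extracted.\<close>

lemma deriv_bessel_kernel':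
  assumes "\<nu> > 0" "t > 0"
  shows "(bessel_kernel' \<nu> has_real_derivative - (1 - (\<nu>\<^sup>2 - 1/4) / t\<^sup>2) * bessel_kernel \<nu> t) (at t)"
proof -
  \<comment> \<open>The lowest power of t in the second derivative; the others are \<open>u\<close>
    times t, t^2 and t^3.\<close>
  define u where "u = t powr (\<nu> - 3/2)"
  have pw: "t powr (a + real n) = t ^ n * t powr a" for a n
    using assms by (simp add: powr_add powr_realpow)
  have p: "t powr (\<nu> - 1/2) = t * u" "t powr (\<nu> + 1/2) = t\<^sup>2 * u" "t powr (\<nu> + 3/2) = t ^ 3 * u"
    using pw[of "\<nu> - 3/2" 1] pw[of "\<nu> - 3/2" 2] pw[of "\<nu> - 3/2" 3] by (simp_all add: u_def add_ac)
  define y where "y = t\<^sup>2 / 4"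
  let ?S = "bessel_series \<nu> y" let ?S' = "bessel_series' \<nu> y" let ?S'' = "bessel_series'' \<nu> y"
  have "(bessel_kernel' \<nu> has_real_derivative
      2 powr - \<nu> * ((\<nu> + 1/2) * ((\<nu> - 1/2) * t powr (\<nu> - 3/2) * ?S + t powr (\<nu> - 1/2) * (?S' * (t / 2)))
       + ((\<nu> + 3/2) * t powr (\<nu> + 1/2) / 2 * ?S' + t powr (\<nu> + 3/2) / 2 * (?S'' * (t / 2))))) (at t)"
    unfolding bessel_kernel'_def[abs_def] y_def using assms
    by (auto intro!: derivative_eq_intros DERIV_chain2[OF bessel_series_deriv(1)]
        DERIV_chain2[OF bessel_series_deriv(2)] simp: field_simps)
  also have "2 powr - \<nu> * ((\<nu> + 1/2) * ((\<nu> - 1/2) * t powr (\<nu> - 3/2) * ?S + t powr (\<nu> - 1/2) * (?S' * (t / 2)))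
       + ((\<nu> + 3/2) * t powr (\<nu> + 1/2) / 2 * ?S' + t powr (\<nu> + 3/2) / 2 * (?S'' * (t / 2))))
     = 2 powr - \<nu> * u * ((\<nu>\<^sup>2 - 1/4) * ?S + t\<^sup>2 * ((\<nu> + 1) * ?S' + y * ?S''))"
    unfolding p u_def[symmetric] y_def by (simp add: field_simps power2_eq_square power3_eq_cube)
  also have "(\<nu> + 1) * ?S' + y * ?S'' = - ?S"
    using bessel_series_ode[OF assms(1), of y] by linarith
  also have "2 powr - \<nu> * u * ((\<nu>\<^sup>2 - 1/4) * ?S + t\<^sup>2 * - ?S)
      = - (1 - (\<nu>\<^sup>2 - 1/4) / t\<^sup>2) * bessel_kernel \<nu> t"
    unfolding bessel_kernel_def p y_def[symmetric] using assms by (simp add: field_simps)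
  finally show ?thesis .
qed

lemma continuous_on_bessel_series_sq:
  assumes "\<nu> > 0"
  shows "continuous_on A (\<lambda>t. bessel_series \<nu> (t\<^sup>2 / 4))"
    and "continuous_on A (\<lambda>t. bessel_series' \<nu> (t\<^sup>2 / 4))"
  by (rule continuous_on_compose2[OF continuous_on_bessel_series(1)[OF assms, of UNIV]]
      continuous_on_compose2[OF continuous_on_bessel_series(2)[OF assms, of UNIV]],
      auto intro!: continuous_intros)+

text \<open>The smallest exponent, \<nu> - 1/2 in \<open>bessel_kernel'\<close>, is positive because
  \<nu> > 1/2, so continuity extends to 0.\<close>

lemma continuous_on_bessel_kernel:
  assumes "\<nu> > 1/2"
  shows "continuous_on {0..} (bessel_kernel \<nu>)" and "continuous_on {0..} (bessel_kernel' \<nu>)"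
proof -
  have "continuous_on {0..} (\<lambda>t. bessel_series \<nu> (t\<^sup>2 / 4))"
    "continuous_on {0..} (\<lambda>t. bessel_series' \<nu> (t\<^sup>2 / 4))"
    using assms by (auto intro!: continuous_on_bessel_series_sq)
  then show "continuous_on {0..} (bessel_kernel \<nu>)" "continuous_on {0..} (bessel_kernel' \<nu>)"
    unfolding bessel_kernel_def[abs_def] bessel_kernel'_def[abs_def] using assms
    by (auto intro!: continuous_on_mult continuous_on_add continuous_on_powr' continuous_on_divide continuous_on_id continuous_on_const)
qed

text \<open>The series is continuous with value 1 / Gamma(\<nu> + 1) > 0 at y = 0, and the power in
  front is positive.\<close>

lemma bessel_kernel_pos_near_0:
  assumes "\<nu> > 0"
  obtains \<delta> where "\<delta> > 0" "\<And>t. 0 < t \<Longrightarrow> t < \<delta> \<Longrightarrow> bessel_kernel \<nu> t > 0"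
proof -
  have "bessel_series \<nu> 0 = rGamma (\<nu> + 1)"
    using powser_zero[of "bessel_coeff \<nu>"] by (simp add: bessel_series_def bessel_coeff_def)
  then have pos: "bessel_series \<nu> 0 > 0"
    using assms Gamma_real_pos[of "\<nu> + 1"] by (simp add: rGamma_inverse_Gamma)
  have "isCont (\<lambda>t. bessel_series \<nu> (t\<^sup>2 / 4)) 0"
    using continuous_on_bessel_series_sq(1)[OF assms, of UNIV]
    by (simp add: continuous_on_eq_continuous_at)
  then have "((\<lambda>t. bessel_series \<nu> (t\<^sup>2 / 4)) \<longlongrightarrow> bessel_series \<nu> 0) (at 0)"
    by (auto dest: isContD)
  then have "((\<lambda>t. bessel_series \<nu> (t\<^sup>2 / 4)) \<longlongrightarrow> bessel_series \<nu> 0) (at_right 0)"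
    by (rule tendsto_mono[OF at_le, rotated]) auto
  then have "\<forall>\<^sub>F t in at_right 0. bessel_series \<nu> (t\<^sup>2 / 4) > 0"
    using pos order_tendstoD(1) by blast
  then obtain \<delta> where "\<delta> > 0" "\<And>t. 0 < t \<Longrightarrow> t < \<delta> \<Longrightarrow> bessel_series \<nu> (t\<^sup>2 / 4) > 0"
    by (auto simp: eventually_at_right_field)
  with that show ?thesis by (simp add: bessel_kernel_def)
qed

section \<open>Convergence and positivity of improper integrals by the second mean value
  theorem\<close>

section \<open>Improper integrals with a monotone factor\<close>

lemma has_integral_deriv_pos:
  fixes h H :: "real \<Rightarrow> real"
  assumes "\<And>t. t > 0 \<Longrightarrow> (H has_real_derivative h t) (at t)" "0 < s" "s \<le> t"
  shows "(h has_integral (H t - H s)) {s..t}"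
proof (rule fundamental_theorem_of_calculus[OF assms(3)])
  fix x assume "x \<in> {s..t}"
  then have "(H has_real_derivative h x) (at x)" using assms by simp
  then show "(H has_vector_derivative h x) (at x within {s..t})"
    using has_field_derivative_at_within has_real_derivative_iff_has_vector_derivative by blast
qed

text \<open>The second mean value theorem for nondecreasing weights is applied to - f and the result
  negated; integrals of h become differences of its primitive H.\<close>

lemma antimono_second_mean_value:
  fixes f h H :: "real \<Rightarrow> real"
  assumes "antimono_on {0<..} f" "0 < a" "a \<le> b"
    and deriv: "\<And>t. t > 0 \<Longrightarrow> (H has_real_derivative h t) (at t)"
  obtains c where "c \<in> {a..b}"
    and "((\<lambda>t. f t * h t) has_integral (f a * (H c - H a) + f b * (H b - H c))) {a..b}"
proof -
  have h: "(h has_integral (H t - H s)) {s..t}" if "a \<le> s" "s \<le> t" for s t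
    using has_integral_deriv_pos[OF deriv] that \<open>0 < a\<close> by simp
  have "- f s \<le> - f t" if "a \<le> s" "s \<le> t" for s t
    using that assms(1,2) by (auto simp: monotone_on_def)
  then obtain c where c: "c \<in> {a..b}"
    and *: "((\<lambda>t. - f t * h t) has_integral (- f a * integral {a..c} h + - f b * integral {c..b} h)) {a..b}"
    by (rule second_mean_value_theorem_full
        [OF has_integral_integrable[OF h[OF order_refl assms(3)]] assms(3), of "\<lambda>t. - f t"])
  have "integral {a..c} h = H c - H a" "integral {c..b} h = H b - H c"
    using h[of a c] h[of c b] c by (auto intro: integral_unique)
  with has_integral_neg[OF *] c show ?thesis
    by (intro that[of c]) (simp_all add: add.commute)
qed

text \<open>The Cauchy criterion, phrased for ordered pairs because the difference of two partial
  integrals is then the integral over [r, s].\<close>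

lemma tendsto_at_top_cauchy:
  fixes I :: "real \<Rightarrow> real"
  assumes "\<And>e. e > 0 \<Longrightarrow> \<exists>N. \<forall>r s. N \<le> r \<longrightarrow> r \<le> s \<longrightarrow> \<bar>I s - I r\<bar> < e"
  obtains L where "(I \<longlongrightarrow> L) at_top"
proof -
  have "cauchy_filter (filtermap I at_top)"
    unfolding cauchy_filter_metric_filtermap
  proof (intro allI impI)
    fix e :: real assume "e > 0"
    then obtain N where N: "\<And>r s. N \<le> r \<Longrightarrow> r \<le> s \<Longrightarrow> \<bar>I s - I r\<bar> < e" using assms by blast
    have "dist (I x) (I y) < e" if "N \<le> x" "N \<le> y" for x y
      using N[of x y] N[of y x] that by (cases "x \<le> y") (auto simp: dist_real_def)
    then show "\<exists>P. eventually P at_top \<and> (\<forall>x y. P x \<and> P y \<longrightarrow> dist (I x) (I y) < e)"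
      by (intro exI[of _ "\<lambda>x. N \<le> x"]) (auto simp: eventually_ge_at_top)
  qed
  then have "convergent_filter (filtermap I at_top)" by (rule cauchy_filter_convergent)
  then show ?thesis
    using that by (auto simp: convergent_filter_iff filterlim_def)
qed

text \<open>Convergence at infinity is Dirichlet's test: H is bounded and f decreases to 0. For
  positivity, f is bounded below by f(a) on (0, a], where h \<ge> 0; on [a, R] the second mean value
  theorem yields a value H(c) with c \<ge> a, which stays above some m > 0.\<close>

lemma improper_integral_antimono_pos:
  fixes f h H :: "real \<Rightarrow> real" and K \<delta> :: real
  assumes f_nonneg: "\<And>t. t > 0 \<Longrightarrow> f t \<ge> 0"
    and f_antimono: "antimono_on {0<..} f"
    and f_nonzero: "\<exists>t>0. f t \<noteq> 0"
    and f_tendsto: "(f \<longlongrightarrow> 0) at_top"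
    and deriv: "\<And>t. t > 0 \<Longrightarrow> (H has_real_derivative h t) (at t)"
    and H_tendsto: "(H \<longlongrightarrow> 0) (at_right 0)"
    and H_bounds: "\<And>t. t > 0 \<Longrightarrow> 0 \<le> H t" "\<And>t. t > 0 \<Longrightarrow> H t \<le> K"
    and H_below: "\<And>a. a > 0 \<Longrightarrow> \<exists>m>0. \<forall>t\<ge>a. m \<le> H t"
    and h_nonneg: "\<delta> > 0" "\<And>t. 0 < t \<Longrightarrow> t < \<delta> \<Longrightarrow> 0 \<le> h t"
    and integrable_0: "(\<lambda>t. f t * h t) integrable_on {0..1}"
  shows "improper_integrable (\<lambda>t. f t * h t) \<and> improper_integral (\<lambda>t. f t * h t) > 0"
proof -
  define g where "g t = f t * h t" for t
  have f_le: "f t \<le> f s" if "0 < s" "s \<le> t" for s t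
    using that f_antimono by (auto simp: monotone_on_def)
  have mean_value: "\<exists>c\<in>{a..b}. (g has_integral (f a * (H c - H a) + f b * (H b - H c))) {a..b}"
    if "0 < a" "a \<le> b" for a b
    unfolding g_def[abs_def] using antimono_second_mean_value[OF f_antimono that deriv] by blast
  have integrable: "g integrable_on {a..b}" if "0 < a" for a b
  proof (cases "a \<le> b")
    case True
    with that show ?thesis using mean_value[of a b] by (auto simp: integrable_on_def)
  qed auto
  have "K \<ge> 0" using H_bounds[of 1] by simp
  \<comment> \<open>Both increments of H lie in [-K, K] and f s \<le> f r, so f r alone controls the
    tail.\<close>
  have tail: "\<bar>integral {r..s} g\<bar> \<le> f r * (2 * K)" if "0 < r" "r \<le> s" for r s
  proof -
    obtain c where c: "c \<in> {r..s}" "(g has_integral (f r * (H c - H r) + f s * (H s - H c))) {r..s}"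
      using mean_value[OF \<open>0 < r\<close> \<open>r \<le> s\<close>] by blast
    have K: "\<bar>H c - H r\<bar> \<le> K" "\<bar>H s - H c\<bar> \<le> K"
      using H_bounds[of c] H_bounds[of r] H_bounds[of s] c that by auto
    have "\<bar>f r * (H c - H r)\<bar> \<le> f r * K" "\<bar>f s * (H s - H c)\<bar> \<le> f r * K"
      unfolding abs_mult using K that f_nonneg[of r] f_nonneg[of s] f_le[of r s] \<open>K \<ge> 0\<close>
      by (auto intro!: mult_mono)
    moreover have "integral {r..s} g = f r * (H c - H r) + f s * (H s - H c)"
      using c(2) by (rule integral_unique)
    ultimately show ?thesis by linarith
  qed
  obtain B where B: "((\<lambda>R. integral {1..R} g) \<longlongrightarrow> B) at_top"
  proof (rule tendsto_at_top_cauchy)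
    fix e :: real assume "e > 0"
    have "((\<lambda>r. f r * (2 * K)) \<longlongrightarrow> 0 * (2 * K)) at_top" by (intro tendsto_intros f_tendsto)
    then have "\<forall>\<^sub>F r in at_top. f r * (2 * K) < e" using \<open>e > 0\<close> order_tendstoD(2) by fastforce
    then obtain N where N: "\<And>r. N \<le> r \<Longrightarrow> f r * (2 * K) < e" by (auto simp: eventually_at_top_linorder)
    have "\<bar>integral {1..s} g - integral {1..r} g\<bar> < e" if "max 1 N \<le> r" "r \<le> s" for r s
    proof -
      have "integral {1..r} g + integral {r..s} g = integral {1..s} g"
        using that by (intro Henstock_Kurzweil_Integration.integral_combine integrable) auto
      with tail[of r s] N[of r] that show ?thesis by auto
    qed
    then show "\<exists>N. \<forall>r s. N \<le> r \<longrightarrow> r \<le> s \<longrightarrow> \<bar>integral {1..s} g - integral {1..r} g\<bar> < e" by blast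
  qed
  \<comment> \<open>An integral that exists on [0, 1] depends continuously on its lower endpoint,
    which gives the limit at 0.\<close>
  have "continuous_on {0..1} (\<lambda>\<epsilon>. integral {\<epsilon>..1} g)"
    using integrable_0 unfolding g_def[abs_def] by (rule indefinite_integral_continuous_1')
  then have "((\<lambda>\<epsilon>. integral {\<epsilon>..1} g) \<longlongrightarrow> integral {0..1} g) (at 0 within {0..1})"
    by (auto simp: continuous_on_def)
  then have A: "((\<lambda>\<epsilon>. integral {\<epsilon>..1} g) \<longlongrightarrow> integral {0..1} g) (at_right 0)"
    by (simp add: at_within_Icc_at_right)
  define L where "L = integral {0..1} g + B"
  let ?F = "at_right (0::real) \<times>\<^sub>F (at_top :: real filter)"
  have near_ev: "\<forall>\<^sub>F p in ?F. (0 < fst p \<and> fst p < a) \<and> snd p \<ge> b" if "a > 0" for a b :: real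
    using that by (intro eventually_prodI eventually_ge_at_top eventually_at_rightI[of 0 a]) auto
  \<comment> \<open>Splitting at 1 separates the two limits: each summand depends on one coordinate
    of the product filter only.\<close>
  have "((\<lambda>p. integral {fst p..1} g + integral {1..snd p} g) \<longlongrightarrow> L) ?F"
    unfolding L_def
    by (intro tendsto_add filterlim_compose[OF A filterlim_fst] filterlim_compose[OF B filterlim_snd])
  moreover have "\<forall>\<^sub>F p in ?F. integral {fst p..1} g + integral {1..snd p} g = integral {fst p..snd p} g"
    using near_ev[OF zero_less_one, of 1] by (rule eventually_mono) (auto intro!: Henstock_Kurzweil_Integration.integral_combine integrable)
  ultimately have lim: "((\<lambda>p. integral {fst p..snd p} g) \<longlongrightarrow> L) ?F"
    by (rule Lim_transform_eventually)
  have nontriv: "?F \<noteq> bot" by (simp add: prod_filter_eq_bot)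
  have "L > 0"
  proof -
    obtain s where s: "s > 0" "f s \<noteq> 0" using f_nonzero by blast
    \<comment> \<open>As \<open>a\<close> is at most \<open>s\<close>, f a \<ge> f s > 0; as it is
      below \<open>\<delta>\<close>, h is nonnegative on (0, a].\<close>
    define a where "a = min s (\<delta>/2)"
    have a: "a > 0" "a \<le> s" "a < \<delta>" using s h_nonneg(1) by (auto simp: a_def)
    have fa: "f a > 0" using f_le[of a s] f_nonneg[of s] a s by force
    obtain m where m: "m > 0" "\<And>t. t \<ge> a \<Longrightarrow> m \<le> H t" using H_below[OF a(1)] by blast
    \<comment> \<open>This lower bound comes from adding the estimates on [\<epsilon>, a] and
      [a, R], in which the terms f(a) H(a) cancel; its limit is f(a) m.\<close>
    have "((\<lambda>p. f a * (m - H (fst p)) - f (snd p) * K) \<longlongrightarrow> f a * (m - 0) - 0 * K) ?F"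
      by (intro tendsto_intros filterlim_compose[OF H_tendsto filterlim_fst]
          filterlim_compose[OF f_tendsto filterlim_snd])
    moreover have "\<forall>\<^sub>F p in ?F. f a * (m - H (fst p)) - f (snd p) * K \<le> integral {fst p..snd p} g"
      using near_ev[OF a(1), of a]
    proof eventually_elim
      case (elim p)
      define \<epsilon> where "\<epsilon> = fst p"
      define R where "R = snd p"
      have \<epsilon>: "0 < \<epsilon>" "\<epsilon> < a" "a \<le> R" using elim by (auto simp: \<epsilon>_def R_def)
      have "(h has_integral (H a - H \<epsilon>)) {\<epsilon>..a}"
        using has_integral_deriv_pos[OF deriv] \<epsilon> by simp
      then have "((\<lambda>t. f a * h t) has_integral f a * (H a - H \<epsilon>)) {\<epsilon>..a}"
        by (rule has_integral_mult_right)
      moreover have "(g has_integral integral {\<epsilon>..a} g) {\<epsilon>..a}"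
        using \<epsilon> by (intro integrable_integral integrable)
      ultimately have near: "f a * (H a - H \<epsilon>) \<le> integral {\<epsilon>..a} g"
      proof (rule has_integral_le)
        fix t assume "t \<in> {\<epsilon>..a}"
        with \<epsilon> a show "f a * h t \<le> g t"
          unfolding g_def by (intro mult_right_mono f_le h_nonneg) auto
      qed
      obtain c where c: "c \<in> {a..R}" "(g has_integral (f a * (H c - H a) + f R * (H R - H c))) {a..R}"
        using mean_value[OF a(1) \<epsilon>(3)] by blast
      have far: "integral {a..R} g = f a * (H c - H a) + f R * (H R - H c)"
        using c(2) by (rule integral_unique)
      have "f a * m \<le> f a * H c" using m(2)[of c] c fa by auto
      moreover have "f R * - K \<le> f R * (H R - H c)"
        using H_bounds[of R] H_bounds[of c] c a f_nonneg[of R] \<epsilon> by (intro mult_left_mono) auto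
      moreover have "integral {\<epsilon>..a} g + integral {a..R} g = integral {\<epsilon>..R} g"
        using \<epsilon> by (intro Henstock_Kurzweil_Integration.integral_combine integrable) auto
      ultimately show ?case using near far
        unfolding \<epsilon>_def[symmetric] R_def[symmetric] by (simp add: algebra_simps)
    qed
    ultimately have "f a * (m - 0) - 0 * K \<le> L"
      by (rule tendsto_le[OF nontriv lim])
    moreover have "f a * m > 0" using fa m by simp
    ultimately show ?thesis by simp
  qed
  moreover have "improper_integral g = L"
    unfolding improper_integral_def using tendsto_Lim[OF nontriv lim] by (simp add: case_prod_unfold)
  moreover have "improper_integrable g"
    unfolding improper_integrable_def using integrable lim by (auto simp: case_prod_unfold)
  ultimately show ?thesis by (simp add: g_def[abs_def])
qed

section \<open>Application to the kernel of the Hankel transform\<close>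

section \<open>The Hankel transform\<close>

definition bessel_kernel_integral :: "real \<Rightarrow> real \<Rightarrow> real" where
  "bessel_kernel_integral \<nu> t = integral {0..t} (bessel_kernel \<nu>)"

lemma bessel_sturm_kernel:
  assumes "\<nu> > 1/2"
  obtains \<delta> where "sturm_kernel (bessel_kernel \<nu>) (bessel_kernel' \<nu>) (bessel_kernel_integral \<nu>) (\<nu>\<^sup>2 - 1/4) \<delta>"
proof -
  have \<nu>: "\<nu> > 0" using assms by simp
  obtain \<delta> where \<delta>: "\<delta> > 0" "\<And>t. 0 < t \<Longrightarrow> t < \<delta> \<Longrightarrow> bessel_kernel \<nu> t > 0"
    using bessel_kernel_pos_near_0[OF \<nu>] by blast
  note cont = continuous_on_bessel_kernel[OF assms]
  have zero: "bessel_kernel \<nu> 0 = 0" "bessel_kernel' \<nu> 0 = 0"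
    by (simp_all add: bessel_kernel_def bessel_kernel'_def)
  have lim: "(g \<longlongrightarrow> g 0) (at_right 0)" if "continuous_on {0..} g" for g :: "real \<Rightarrow> real"
  proof -
    have "(g \<longlongrightarrow> g 0) (at 0 within {0..})" using that by (simp add: continuous_on_def)
    then show ?thesis by (rule tendsto_mono[OF at_le, rotated]) auto
  qed
  have within: "(bessel_kernel_integral \<nu> has_real_derivative bessel_kernel \<nu> t) (at t within {0..b})"
    if "t \<in> {0..b}" for t b
    unfolding bessel_kernel_integral_def[abs_def]
    using that by (intro integral_has_real_derivative continuous_on_subset[OF cont(1)]) auto
  have deriv: "(bessel_kernel_integral \<nu> has_real_derivative bessel_kernel \<nu> t) (at t)" if "t > 0" for t
    using within[of t "t + 1"] that by (simp add: at_within_Icc_at)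
  \<comment> \<open>The right derivative at 0 is the value 0 of the kernel there; as the primitive
    vanishes at 0, its difference quotient is G(t) / t.\<close>
  have "(bessel_kernel_integral \<nu> has_real_derivative 0) (at_right 0)"
    using within[of 0 1] by (simp add: zero at_within_Icc_at_right)
  then have div: "((\<lambda>t. bessel_kernel_integral \<nu> t / t) \<longlongrightarrow> 0) (at_right 0)"
    by (simp add: has_field_derivative_iff bessel_kernel_integral_def)
  have "((\<lambda>t. bessel_kernel_integral \<nu> t / t * t) \<longlongrightarrow> 0 * 0) (at_right 0)"
    by (intro tendsto_mult div tendsto_ident_at)
  moreover have "\<forall>\<^sub>F t in at_right 0. bessel_kernel_integral \<nu> t / t * t = bessel_kernel_integral \<nu> t"
    by (intro eventually_at_rightI[of 0 1]) auto
  ultimately have "(bessel_kernel_integral \<nu> \<longlongrightarrow> 0) (at_right 0)"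
    using Lim_transform_eventually by fastforce
  moreover have "\<nu>\<^sup>2 - 1/4 > 0"
    using power_strict_mono[OF assms, of 2] by (simp add: power_divide)
  ultimately have "sturm_kernel (bessel_kernel \<nu>) (bessel_kernel' \<nu>) (bessel_kernel_integral \<nu>) (\<nu>\<^sup>2 - 1/4) \<delta>"
    using \<delta> \<nu> deriv div lim[OF cont(1)] lim[OF cont(2)]
      deriv_bessel_kernel[OF \<nu>] deriv_bessel_kernel'[OF \<nu>]
    by unfold_locales (auto simp: zero)
  then show ?thesis by (rule that)
qed

text \<open>The integrand is t^(\<nu> + 1/2) f(t), Lebesgue integrable on (0, 1) by hypothesis,
  times a bounded continuous factor.\<close>

lemma bessel_kernel_integrable_near_0:
  fixes f :: "real \<Rightarrow> real"
  assumes "\<nu> > 0" "x > 0"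
    and nonneg: "\<And>t. t > 0 \<Longrightarrow> f t \<ge> 0"
    and antimono: "antimono_on {0<..} f"
    and finite: "(\<integral>\<^sup>+t\<in>{0<..<1}. ennreal (t powr (\<nu> + 1 / 2) * f t) \<partial>lborel) < \<infinity>"
  shows "(\<lambda>t. f t * bessel_kernel \<nu> (x * t)) integrable_on {0..1}"
proof -
  define p where "p t = t powr (\<nu> + 1/2) * f t" for t
  \<comment> \<open>Measurability comes from monotonicity: the sign change makes the function
    increasing, and the indicator discards the arbitrary values outside (0, oo).\<close>
  have "mono_on {0<..} (\<lambda>t. - f t)" using antimono by (auto simp: monotone_on_def)
  then have "(\<lambda>t. - f t) \<in> borel_measurable (restrict_space borel {0<..})"
    by (rule borel_measurable_mono_on_fnc)
  then have "(\<lambda>t. indicator {0<..} t *\<^sub>R - f t) \<in> borel_measurable borel"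
    by (subst (asm) borel_measurable_restrict_space_iff) auto
  then have [measurable]: "(\<lambda>t. indicator {0<..} t * - f t) \<in> borel_measurable borel" by simp
  have "(\<lambda>t. indicator {0<..<1} t * t powr (\<nu> + 1/2) * - (indicator {0<..} t * - f t))
      \<in> borel_measurable borel" by measurable
  also have "(\<lambda>t. indicator {0<..<1} t * t powr (\<nu> + 1/2) * - (indicator {0<..} t * - f t))
      = (\<lambda>t. indicator {0<..<1} t *\<^sub>R p t)"
    by (auto simp: p_def fun_eq_iff split: split_indicator)
  finally have meas: "(\<lambda>t. indicator {0<..<1} t *\<^sub>R p t) \<in> borel_measurable borel" .
  have "set_integrable lborel {0<..<1} p"
    unfolding set_integrable_def
  proof (rule integrableI_bounded)
    have "(\<integral>\<^sup>+t. ennreal (norm (indicator {0<..<1} t *\<^sub>R p t)) \<partial>lborel)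
        = (\<integral>\<^sup>+t\<in>{0<..<1}. ennreal (t powr (\<nu> + 1 / 2) * f t) \<partial>lborel)"
      by (intro nn_integral_cong) (auto simp: p_def abs_mult nonneg split: split_indicator)
    with finite show "(\<integral>\<^sup>+t. ennreal (norm (indicator {0<..<1} t *\<^sub>R p t)) \<partial>lborel) < \<infinity>" by simp
  qed (use meas in simp)
  then have p: "p absolutely_integrable_on {0<..<1}"
    using meas by (simp add: set_integrable_def integrable_completion)
  \<comment> \<open>The continuous factor that is left when t^(\<nu> + 1/2) is split off from the
    kernel at x t.\<close>
  define k where "k t = 2 powr - \<nu> * (x powr (\<nu> + 1/2) * bessel_series \<nu> ((x * t)\<^sup>2 / 4))" for t
  have k: "continuous_on A k" for A
    unfolding k_def[abs_def]
    by (intro continuous_intros continuous_on_compose2[OF continuous_on_bessel_series(1)[OF assms(1), of UNIV]]) auto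
  have "bounded (k ` {0..1})"
    by (intro compact_imp_bounded compact_continuous_image k) simp
  then have "bounded (k ` {0<..<1})" by (rule bounded_subset) auto
  moreover have "k \<in> borel_measurable (lebesgue_on {0<..<1})"
    by (intro continuous_imp_measurable_on_sets_lebesgue k) simp
  ultimately have "(\<lambda>t. k t * p t) absolutely_integrable_on {0<..<1}"
    using p by (intro absolutely_integrable_bounded_measurable_product_real) simp_all
  then have "(\<lambda>t. k t * p t) integrable_on {0<..<1}"
    by (rule set_lebesgue_integral_eq_integral(1))
  then have "(\<lambda>t. k t * p t) integrable_on {0..1}" by (simp add: integrable_on_Icc_iff_Ioo)
  \<comment> \<open>At t = 0 both integrands vanish because \<open>0 powr a = 0\<close>, whatever
    value f takes there.\<close>
  then show ?thesis
    by (rule integrable_eq) (use assms in \<open>auto simp: k_def p_def bessel_kernel_def powr_mult\<close>)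
qed

theorem theorem5p1:
  fixes \<nu> :: real and f :: "real \<Rightarrow> real"
  assumes "\<nu> > 1 / 2"
    and "\<And>t. t > 0 \<Longrightarrow> f t \<ge> 0"
    and "sectionally_continuous f"
    and "antimono_on {0<..} f"
    and "\<exists>t>0. f t \<noteq> 0"
    and "(\<integral>\<^sup>+t\<in>{0<..<1}. ennreal (t powr (\<nu> + 1 / 2) * f t) \<partial>lborel) < \<infinity>"
    and "(f \<longlongrightarrow> 0) at_top"
  shows "\<forall>x>0. improper_integrable (hankel_integrand \<nu> f x) \<and> hankel_transform \<nu> f x > 0"
proof (intro allI impI)
  fix x :: real assume x: "x > 0"
  obtain \<delta> where "sturm_kernel (bessel_kernel \<nu>) (bessel_kernel' \<nu>) (bessel_kernel_integral \<nu>) (\<nu>\<^sup>2 - 1/4) \<delta>"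
    using bessel_sturm_kernel[OF assms(1)] by blast
  then interpret sturm_kernel "bessel_kernel \<nu>" "bessel_kernel' \<nu>" "bessel_kernel_integral \<nu>" "\<nu>\<^sup>2 - 1/4" \<delta> .
  define h where "h t = bessel_J \<nu> (x * t) * sqrt (x * t)" for t
  have h: "h t = bessel_kernel \<nu> (x * t)" if "t \<ge> 0" for t
    using bessel_kernel_eq[of "x * t" \<nu>] that x by (simp add: h_def)
  obtain K where K: "\<And>t. t > 0 \<Longrightarrow> bessel_kernel_integral \<nu> t \<le> K" using G_bounded by blast
  \<comment> \<open>By the substitution s = x t, G(x t) / x is a primitive of h; the bounds for G
    rescale by 1 / x, and h is positive on (0, \<delta> / x).\<close>
  have "improper_integrable (\<lambda>t. f t * h t) \<and> improper_integral (\<lambda>t. f t * h t) > 0"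
  proof (rule improper_integral_antimono_pos[where H = "\<lambda>t. bessel_kernel_integral \<nu> (x * t) / x"
        and K = "K / x" and \<delta> = "\<delta> / x"])
    show "((\<lambda>t. bessel_kernel_integral \<nu> (x * t) / x) has_real_derivative h t) (at t)"
      if "t > 0" for t
      using that x by (auto simp: h intro!: derivative_eq_intros DERIV_chain2[OF deriv_G])
    have "filterlim (\<lambda>t. x * t) (at_right 0) (at_right 0)"
      using filtermap_times_pos_at_right[OF x, of 0] by (simp add: filterlim_def)
    from filterlim_compose[OF tendsto_G this]
    show "((\<lambda>t. bessel_kernel_integral \<nu> (x * t) / x) \<longlongrightarrow> 0) (at_right 0)"
      by (rule tendsto_divide_zero)
    show "0 \<le> bessel_kernel_integral \<nu> (x * t) / x" if "t > 0" for t
      using G_pos[of "x * t"] that x by simp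
    show "bessel_kernel_integral \<nu> (x * t) / x \<le> K / x" if "t > 0" for t
      using K[of "x * t"] that x by (simp add: divide_right_mono)
    show "\<exists>m>0. \<forall>t\<ge>a. m \<le> bessel_kernel_integral \<nu> (x * t) / x" if "a > 0" for a
    proof -
      obtain m where "m > 0" "\<And>t. t \<ge> x * a \<Longrightarrow> bessel_kernel_integral \<nu> t \<ge> m"
        using G_bounded_below[OF mult_pos_pos[OF x \<open>a > 0\<close>]] by blast
      then show ?thesis
        using x by (intro exI[of _ "m / x"]) (auto intro!: divide_right_mono)
    qed
    show "0 \<le> h t" if "0 < t" "t < \<delta> / x" for t
      using \<phi>_pos[of "x * t"] that x by (simp add: h field_simps)
    have "(\<lambda>t. f t * bessel_kernel \<nu> (x * t)) integrable_on {0..1}"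
      using assms x by (intro bessel_kernel_integrable_near_0) auto
    then show "(\<lambda>t. f t * h t) integrable_on {0..1}"
      by (rule integrable_eq) (simp add: h)
  qed (use assms x \<delta>_pos in auto)
  moreover have "hankel_integrand \<nu> f x = (\<lambda>t. f t * h t)"
    by (simp add: fun_eq_iff hankel_integrand_def h_def mult.assoc)
  ultimately show "improper_integrable (hankel_integrand \<nu> f x) \<and> hankel_transform \<nu> f x > 0"
    by (simp add: hankel_transform_def)
qed

end
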